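(* Let $P$ be a FASP program. If an interpretation $I$ of $P$ is a model of the completion $comp(P)$ and $I\ne\Pi_{P^I}^{*}$, where $\Pi_{P^I}^{*}$ is the least fixpoint of the immediate consequence operator of the reduct $P^I$, then there exists a loop $L$ of $P$ with $L\subseteq supp(I\circleddash\Pi_{P^I}^{*})$ such that $I\not\models\mathbb{LF}(L,P)$, where $\mathbb{LF}(L,P)$ is the loop formula of $L$.
   Context: "Increasing" and "decreasing" are meant in the non-strict sense. A t-norm is an increasing, commutative, associative map $\mathcal{T}:[0,1]^2\to[0,1]$ with $\mathcal{T}(1,x)=x$ for all $x$; all t-norms are assumed left-continuous. The residual implicator of $\mathcal{T}$ is $\mathcal{I}(x,y)=\sup\{\lambda\in[0,1]\mid \mathcal{T}(x,\lambda)\le y\}$, and its biresiduum is $x\approx y=\mathcal{T}(\mathcal{I}(x,y),\mathcal{I}(y,x))$. A negator is a decreasing map $\mathcal{N}:[0,1]\to[0,1]$ with $\mathcal{N}(0)=1$, $\mathcal{N}(1)=0$. FASP programs. A literal is either an atom or a constant from $[0,1]$. An extended literal is either a literal (positive extended literal) or an expression $\mathcal{N}(a)$ with $a$ an atom and $\mathcal{N}$ an arbitrary negator (negative extended literal). A rule $r$ has the form $a\leftarrow \mathcal{T}(b_1,\ldots,b_n)$ with $n>0$, $a$ a literal (the head $H(r)$), $b_1,\ldots,b_n$ extended literals (forming the body $B(r)$) and $\mathcal{T}$ an arbitrary t-norm, where $\mathcal{T}(b)=b$ and $\mathcal{T}(b_1,\ldots,b_n)=\mathcal{T}(b_1,\mathcal{T}(b_2,\ldots))$.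 The t-norm and the negators may differ from rule to rule. $Lit^+(B(r))$ is the set of positive extended literals in the body of $r$, and $\mathcal{I}_r$ is the residual implicator of the t-norm in the body of $r$. A FASP program $P$ is a finite set of rules; $\mathcal{B}_P$ is the finite set of all atoms occurring in $P$; for an atom $a$, $P_a$ is the set of rules of $P$ with head $a$. Interpretations. An interpretation $I$ of $P$ is a map $I:\mathcal{B}_P\to[0,1]$, extended by $I(c)=c$ for $c\in[0,1]$, $I(\mathcal{N}(a))=\mathcal{N}(I(a))$, and $I(B(r))=\mathcal{T}(I(b_1),\ldots,I(b_n))$ for a rule $r: a\leftarrow\mathcal{T}(b_1,\ldots,b_n)$. The support is $supp(I)=\{a\in\mathcal{B}_P\mid I(a)>0\}$, and $(I\circleddash J)(a)=\max(0,I(a)-J(a))$. Interpretations are ordered pointwise. Immediate consequence operator and reduct. $\Pi_P$ maps an interpretation $I$ to the interpretation $\Pi_P(I)(l)=\sup\{I(B(r))\mid r\in P_l\}$ for $l\in\mathcal{B}_P$ (with $\sup\emptyset=0$). The reduct $r^I$ of a rule $r$ w.r.t. an interpretation $I$ is obtained by replacing every negative extended literal $\mathcal{N}(b)$ in its body by the constant $I(\mathcal{N}(b))$; $P^I=\{r^I\mid r\in P\}$. $\Pi_{P^I}$ is regarded as an operator on maps $\mathcal{B}_P\to[0,1]$; since $P^I$ has no negative extended literals, it is monotone and has a least fixpoint, denoted $\Pi_{P^I}^{*}$. Completion. Interpretations are extended truth-functionally to fuzzy formulas built from atoms, constants and connectives; $I\models F$ ($I$ is a model of $F$) iff $I(F)=1$,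 and $I\models\Theta$ for a set $\Theta$ iff $I\models F$ for all $F\in\Theta$. The completion $comp(P)$ is the set of formulas $$\{a\approx \max\{B(r)\mid r\in P_a\}\mid a\in\mathcal{B}_P\}\cup\{\mathcal{I}_r(B(r),H(r))\mid r\in P,\ H(r)\in[0,1]\},$$ where $\approx$ is the biresiduum of an arbitrary residual implicator, $B(r)$ as a formula denotes $\mathcal{T}(b_1,\ldots,b_n)$, and $\max\emptyset=0$. Loops and loop formulas. The positive dependency graph of $P$ is the directed graph $G_P$ on $\mathcal{B}_P$ with an edge $(a,b)$ iff there is $r\in P_a$ with $b\in Lit^+(B(r))$. A non-empty set $L\subseteq\mathcal{B}_P$ is a loop of $P$ iff for all $a,b\in L$ there is a path of length $>0$ from $a$ to $b$ in $G_P$ all of whose vertices lie in $L$. For a loop $L=\{l_1,\ldots,l_m\}$ let $R^-_P(L)=\{r\in P\mid H(r)\in L,\ Lit^+(B(r))\cap L=\emptyset\}=\{r_1,\ldots,r_n\}$. The loop formula $\mathbb{LF}(L,P)$ is $\mathcal{I}(\max(l_1,\ldots,l_m),\max(B(r_1),\ldots,B(r_n)))$, where $\mathcal{I}$ is an arbitrary residual implicator; if $R^-_P(L)=\emptyset$ it is $\mathcal{I}(\max(l_1,\ldots,l_m),0)$. *)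

theory Defs
  imports "HOL-Analysis.Analysis" "HOL-Library.FSet"
begin

section \<open>Connectives on the unit interval\<close>

text \<open>Truth values are reals in \<open>{0..1}\<close>; connectives are total functions on the reals, constrained
  (and ever applied) only on \<open>{0..1}\<close>.  Because of commutativity, left-continuity is required in
  the second argument only.\<close>

definition tnorm :: "(real \<Rightarrow> real \<Rightarrow> real) \<Rightarrow> bool" where
  "tnorm T \<longleftrightarrow>
     (\<forall>x\<in>{0..1}. \<forall>y\<in>{0..1}. T x y \<in> {0..1}) \<and>
     (\<forall>x\<in>{0..1}. \<forall>x'\<in>{0..1}. \<forall>y\<in>{0..1}. \<forall>y'\<in>{0..1}. x \<le> x' \<longrightarrow> y \<le> y' \<longrightarrow> T x y \<le> T x' y') \<and>
     (\<forall>x\<in>{0..1}. \<forall>y\<in>{0..1}. T x y = T y x) \<and>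
     (\<forall>x\<in>{0..1}. \<forall>y\<in>{0..1}. \<forall>z\<in>{0..1}. T x (T y z) = T (T x y) z) \<and>
     (\<forall>x\<in>{0..1}. T 1 x = x)"

definition left_continuous_tnorm :: "(real \<Rightarrow> real \<Rightarrow> real) \<Rightarrow> bool" where
  "left_continuous_tnorm T \<longleftrightarrow>
     tnorm T \<and> (\<forall>x\<in>{0..1}. \<forall>y\<in>{0<..1}. continuous (at_left y) (T x))"

definition residual_implicator :: "(real \<Rightarrow> real \<Rightarrow> real) \<Rightarrow> real \<Rightarrow> real \<Rightarrow> real" where
  "residual_implicator T x y = Sup {l \<in> {0..1}. T x l \<le> y}"

definition negator :: "(real \<Rightarrow> real) \<Rightarrow> bool" where
  "negator N \<longleftrightarrow> N \<in> {0..1} \<rightarrow> {0..1} \<and> antimono_on {0..1} N \<and> N 0 = 1 \<and> N 1 = 0"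


section \<open>Programs\<close>

datatype 'a literal = Atom 'a | Const real

datatype 'a ext_literal = Pos "'a literal" | Neg "real \<Rightarrow> real" 'a

datatype 'a rule =
  Rule (head: "'a literal") (rule_tnorm: "real \<Rightarrow> real \<Rightarrow> real") (body: "'a ext_literal list")

fun wf_literal :: "'a literal \<Rightarrow> bool" where
  "wf_literal (Atom a) \<longleftrightarrow> True"
| "wf_literal (Const c) \<longleftrightarrow> c \<in> {0..1}"

fun wf_ext_literal :: "'a ext_literal \<Rightarrow> bool" where
  "wf_ext_literal (Pos l) \<longleftrightarrow> wf_literal l"
| "wf_ext_literal (Neg N a) \<longleftrightarrow> negator N"

definition wf_rule :: "'a rule \<Rightarrow> bool" where
  "wf_rule r \<longleftrightarrow> wf_literal (head r) \<and> left_continuous_tnorm (rule_tnorm r) \<and>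
     body r \<noteq> [] \<and> (\<forall>b\<in>set (body r). wf_ext_literal b)"

definition fasp_program :: "'a rule set \<Rightarrow> bool" where
  "fasp_program P \<longleftrightarrow> finite P \<and> (\<forall>r\<in>P. wf_rule r)"

definition rule_atoms :: "'a rule \<Rightarrow> 'a set" where
  "rule_atoms r = set_literal (head r) \<union> (\<Union>b\<in>set (body r). set_ext_literal b)"

definition atoms :: "'a rule set \<Rightarrow> 'a set" where
  "atoms P = (\<Union>r\<in>P. rule_atoms r)"

definition rules_for :: "'a rule set \<Rightarrow> 'a \<Rightarrow> 'a rule set" where
  "rules_for P a = {r \<in> P. head r = Atom a}"

definition pos_literals :: "'a rule \<Rightarrow> 'a literal set" where
  "pos_literals r = {l. Pos l \<in> set (body r)}"


section \<open>Formulas and interpretations\<close>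

text \<open>Every implication carries the t-norm whose residual implicator it denotes.\<close>

datatype 'a formula =
    Lit "'a literal"
  | Negation "real \<Rightarrow> real" "'a formula"
  | Conj "real \<Rightarrow> real \<Rightarrow> real" "'a formula" "'a formula"
  | Impl "real \<Rightarrow> real \<Rightarrow> real" "'a formula" "'a formula"
  | Maximum "'a formula fset"

fun eval_literal :: "('a \<Rightarrow> real) \<Rightarrow> 'a literal \<Rightarrow> real" where
  "eval_literal I (Atom a) = I a"
| "eval_literal I (Const c) = c"

primrec eval_formula :: "('a \<Rightarrow> real) \<Rightarrow> 'a formula \<Rightarrow> real" where
  "eval_formula I (Lit l) = eval_literal I l"
| "eval_formula I (Negation N F) = N (eval_formula I F)"
| "eval_formula I (Conj T F G) = T (eval_formula I F) (eval_formula I G)"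
| "eval_formula I (Impl T F G) = residual_implicator T (eval_formula I F) (eval_formula I G)"
| "eval_formula I (Maximum Fs) =
     (let V = eval_formula I |`| Fs in if V = {||} then 0 else fMax V)"

definition models :: "('a \<Rightarrow> real) \<Rightarrow> 'a formula \<Rightarrow> bool" (infix "\<Turnstile>" 50) where
  "I \<Turnstile> F \<longleftrightarrow> eval_formula I F = 1"

definition models_set :: "('a \<Rightarrow> real) \<Rightarrow> 'a formula set \<Rightarrow> bool" (infix "\<Turnstile>\<^sub>s" 50) where
  "I \<Turnstile>\<^sub>s \<Theta> \<longleftrightarrow> (\<forall>F\<in>\<Theta>. I \<Turnstile> F)"

definition biresiduum :: "(real \<Rightarrow> real \<Rightarrow> real) \<Rightarrow> 'a formula \<Rightarrow> 'a formula \<Rightarrow> 'a formula" where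
  "biresiduum T F G = Conj T (Impl T F G) (Impl T G F)"

text \<open>Only meaningful for finite sets of formulas.\<close>

definition max_formula :: "'a formula set \<Rightarrow> 'a formula" where
  "max_formula A = Maximum (Abs_fset A)"

fun ext_literal_formula :: "'a ext_literal \<Rightarrow> 'a formula" where
  "ext_literal_formula (Pos l) = Lit l"
| "ext_literal_formula (Neg N a) = Negation N (Lit (Atom a))"

text \<open>The first equation is a filler: bodies of rules are non-empty.\<close>

fun conj_formula :: "(real \<Rightarrow> real \<Rightarrow> real) \<Rightarrow> 'a formula list \<Rightarrow> 'a formula" where
  "conj_formula T [] = Lit (Const 1)"
| "conj_formula T [F] = F"
| "conj_formula T (F # G # Gs) = Conj T F (conj_formula T (G # Gs))"

definition body_formula :: "'a rule \<Rightarrow> 'a formula" where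
  "body_formula r = conj_formula (rule_tnorm r) (map ext_literal_formula (body r))"

text \<open>Interpretations are extensional, so that equality and the library's pointwise order on
  functions amount to equality and order on the atoms of the program.\<close>

definition interpretations :: "'a rule set \<Rightarrow> ('a \<Rightarrow> real) set" where
  "interpretations P = atoms P \<rightarrow>\<^sub>E {0..1}"

definition interp_diff :: "'a rule set \<Rightarrow> ('a \<Rightarrow> real) \<Rightarrow> ('a \<Rightarrow> real) \<Rightarrow> ('a \<Rightarrow> real)" where
  "interp_diff P I J = (\<lambda>a\<in>atoms P. max 0 (I a - J a))"

definition supp :: "'a rule set \<Rightarrow> ('a \<Rightarrow> real) \<Rightarrow> 'a set" where
  "supp P I = {a \<in> atoms P. I a > 0}"


section \<open>Immediate consequences and the reduct\<close>

text \<open>The set \<open>B\<close> of atoms is a parameter since the operator of a reduct of \<open>P\<close> acts on maps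
  defined on the atoms of \<open>P\<close>, some of which may not occur in the reduct.\<close>

definition immediate_consequence ::
    "'a set \<Rightarrow> 'a rule set \<Rightarrow> ('a \<Rightarrow> real) \<Rightarrow> ('a \<Rightarrow> real)" where
  "immediate_consequence B P I =
     (\<lambda>a\<in>B. if rules_for P a = {} then 0
            else Sup ((\<lambda>r. eval_formula I (body_formula r)) ` rules_for P a))"

fun reduct_ext_literal :: "('a \<Rightarrow> real) \<Rightarrow> 'a ext_literal \<Rightarrow> 'a ext_literal" where
  "reduct_ext_literal I (Pos l) = Pos l"
| "reduct_ext_literal I (Neg N a) = Pos (Const (N (I a)))"

definition reduct_rule :: "('a \<Rightarrow> real) \<Rightarrow> 'a rule \<Rightarrow> 'a rule" where
  "reduct_rule I r = Rule (head r) (rule_tnorm r) (map (reduct_ext_literal I) (body r))"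

definition reduct :: "'a rule set \<Rightarrow> ('a \<Rightarrow> real) \<Rightarrow> 'a rule set" where
  "reduct P I = reduct_rule I ` P"

definition reduct_least_fixpoint :: "'a rule set \<Rightarrow> ('a \<Rightarrow> real) \<Rightarrow> ('a \<Rightarrow> real)" where
  "reduct_least_fixpoint P I =
     (LEAST J. J \<in> interpretations P \<and> immediate_consequence (atoms P) (reduct P I) J = J)"


section \<open>Completion and loop formulas\<close>

text \<open>The residual implicator underlying the biresiduum is arbitrary; it is given by a t-norm
  that may even vary with the atom.\<close>

definition fasp_completion :: "('a \<Rightarrow> real \<Rightarrow> real \<Rightarrow> real) \<Rightarrow> 'a rule set \<Rightarrow> 'a formula set" where
  "fasp_completion T P =
     {biresiduum (T a) (Lit (Atom a)) (max_formula (body_formula ` rules_for P a)) | a. a \<in> atoms P}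
     \<union> {Impl (rule_tnorm r) (body_formula r) (Lit (head r)) | r. r \<in> P \<and> head r \<in> range Const}"

definition dependency_graph :: "'a rule set \<Rightarrow> ('a \<times> 'a) set" where
  "dependency_graph P = {(a, b). \<exists>r\<in>rules_for P a. Atom b \<in> pos_literals r}"

definition loop :: "'a rule set \<Rightarrow> 'a set \<Rightarrow> bool" where
  "loop P L \<longleftrightarrow> L \<noteq> {} \<and> L \<subseteq> atoms P \<and>
     (\<forall>a\<in>L. \<forall>b\<in>L. (a, b) \<in> (dependency_graph P \<inter> L \<times> L)\<^sup>+)"

definition external_rules :: "'a rule set \<Rightarrow> 'a set \<Rightarrow> 'a rule set" where
  "external_rules P L = {r \<in> P. head r \<in> Atom ` L \<and> pos_literals r \<inter> Atom ` L = {}}"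

text \<open>If there are no external rules, the conclusion of the loop formula is the empty maximum,
  which evaluates to 0.\<close>

definition loop_formula :: "(real \<Rightarrow> real \<Rightarrow> real) \<Rightarrow> 'a set \<Rightarrow> 'a rule set \<Rightarrow> 'a formula" where
  "loop_formula T L P =
     Impl T (max_formula ((\<lambda>l. Lit (Atom l)) ` L))
            (max_formula (body_formula ` external_rules P L))"

end

theory Submission
  imports Defs
begin

text \<open>
  A model \<open>I\<close> of the completion is a fixpoint of the immediate consequence operator of the reduct,
  so the least fixpoint \<open>J\<close> lies below \<open>I\<close>. Let \<open>M\<close> be the largest value of \<open>I\<close> on the
  non-empty set where \<open>J < I\<close>, and let \<open>X\<close> be the set of atoms there that attain it. If a rule
  with head in \<open>X\<close> has a body of value \<open>M\<close> under \<open>I\<close>, then its value under \<open>J\<close> is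
  smaller, so its body contains a positive atom where \<open>J < I\<close>; as a t-norm is below the minimum,
  this atom is again in \<open>X\<close>. Call these pairs of atoms edges. A minimal non-empty subset \<open>L\<close>
  of \<open>X\<close> closed under edges is a loop, and an external rule of \<open>L\<close> cannot have a body of value
  \<open>M\<close>, since it would give an edge leaving \<open>L\<close>.
\<close>

section \<open>Residual implicators\<close>

lemma tnorm_range: "\<lbrakk>tnorm T; x \<in> {0..1}; y \<in> {0..1}\<rbrakk> \<Longrightarrow> T x y \<in> {0..1}"
  unfolding tnorm_def by blast

lemma tnorm_mono:
  "\<lbrakk>tnorm T; x \<in> {0..1}; x' \<in> {0..1}; y \<in> {0..1}; y' \<in> {0..1}; x \<le> x'; y \<le> y'\<rbrakk>
    \<Longrightarrow> T x y \<le> T x' y'"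
  unfolding tnorm_def by blast

lemma tnorm_1_left: "\<lbrakk>tnorm T; x \<in> {0..1}\<rbrakk> \<Longrightarrow> T 1 x = x"
  unfolding tnorm_def by blast

lemma tnorm_1_right: "\<lbrakk>tnorm T; x \<in> {0..1}\<rbrakk> \<Longrightarrow> T x 1 = x"
  unfolding tnorm_def by (metis atLeastAtMost_iff order_refl zero_le_one)

lemma tnorm_le_right: "\<lbrakk>tnorm T; x \<in> {0..1}; y \<in> {0..1}\<rbrakk> \<Longrightarrow> T x y \<le> y"
  using tnorm_mono[of T x 1 y y] tnorm_1_left[of T y] by auto

lemma tnorm_le_left: "\<lbrakk>tnorm T; x \<in> {0..1}; y \<in> {0..1}\<rbrakk> \<Longrightarrow> T x y \<le> x"
  using tnorm_mono[of T x x y 1] tnorm_1_right[of T x] by auto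

lemma residual_implicator_range:
  assumes "tnorm T" "x \<in> {0..1}" "y \<in> {0..1}"
  shows "residual_implicator T x y \<in> {0..1}"
proof -
  \<comment> \<open>The real \<open>Sup\<close> is informative only for non-empty bounded sets; 0 is
    the member that serves here.\<close>
  have "T x 0 \<le> y"
    using tnorm_le_right[of T x 0] assms by auto
  then have "0 \<in> {l \<in> {0..1}. T x l \<le> y}" by simp
  then show ?thesis
    unfolding residual_implicator_def
    by (auto intro!: cSup_least cSup_upper bdd_aboveI[where M = 1])
qed

text \<open>If x is at most y, then 1 itself lies in the set, because T x 1 = x. Conversely, a
  supremum of 1 gives members arbitrarily close to 1, and left-continuity at 1 carries their bound
  over to T x 1 = x.\<close>

lemma residual_implicator_eq_1_iff:
  assumes T: "left_continuous_tnorm T" and x: "x \<in> {0..1}" and y: "y \<in> {0..1}"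
  shows "residual_implicator T x y = 1 \<longleftrightarrow> x \<le> y"
proof
  have tn: "tnorm T" using T unfolding left_continuous_tnorm_def by blast
  have Tx1: "T x 1 = x" using tnorm_1_right[OF tn x] .
  show "residual_implicator T x y = 1" if "x \<le> y"
    unfolding residual_implicator_def
    by (rule cSup_eq_maximum) (use that Tx1 in auto)
  show "x \<le> y" if Sup1: "residual_implicator T x y = 1"
  proof (rule ccontr)
    assume "\<not> x \<le> y"
    then have lt: "y < T x 1" using Tx1 by simp
    have "continuous (at_left 1) (T x)"
      using T x unfolding left_continuous_tnorm_def by auto
    then have "(T x \<longlongrightarrow> T x 1) (at_left 1)"
      by (simp add: continuous_within)
    then have "eventually (\<lambda>l. y < T x l) (at_left 1)"
      using lt by (rule order_tendstoD(1))
    then obtain b where b: "b < 1" "\<And>l. b < l \<Longrightarrow> l < 1 \<Longrightarrow> y < T x l"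
      unfolding eventually_at_left_field by blast
    have "T x 0 \<le> y"
      using tnorm_le_right[OF tn x, of 0] y by auto
    then have "{l \<in> {0..1}. T x l \<le> y} \<noteq> {}" by force
    moreover have "b < Sup {l \<in> {0..1}. T x l \<le> y}"
      using Sup1 b(1) unfolding residual_implicator_def by simp
    ultimately obtain l where l: "l \<in> {0..1}" "T x l \<le> y" "b < l"
      using less_cSupE by blast
    show False
      using l b(2)[of l] lt by (cases "l = 1") auto
  qed
qed

section \<open>Evaluation of formulas\<close>

text \<open>Removes the \<open>Abs_fset\<close> encoding, which \<open>fset\<close> inverts on
  finite sets, in favour of the ordinary \<open>Max\<close>.\<close>

lemma eval_max_formula:
  assumes "finite A"
  shows "eval_formula I (max_formula A) = (if A = {} then 0 else Max (eval_formula I ` A))"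
proof -
  have A: "fset (Abs_fset A) = A" using assms by (simp add: Abs_fset_inverse)
  have "Abs_fset A = {||} \<longleftrightarrow> A = {}"
    using A by (metis bot_fset.rep_eq fset_inverse)
  then show ?thesis
    by (simp add: max_formula_def Let_def fMax.F.rep_eq A)
qed

lemma eval_max_formula_attained:
  "\<lbrakk>finite A; A \<noteq> {}\<rbrakk> \<Longrightarrow> \<exists>F\<in>A. eval_formula I (max_formula A) = eval_formula I F"
  using Max_in[of "eval_formula I ` A"] by (auto simp: eval_max_formula simp del: Max_in)

lemma eval_max_formula_range:
  assumes "finite A" "\<And>F. F \<in> A \<Longrightarrow> eval_formula I F \<in> {0..1}"
  shows "eval_formula I (max_formula A) \<in> {0..1}"
  using eval_max_formula_attained[of A I] assms
  by (cases "A = {}") (auto simp: eval_max_formula)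

text \<open>A t-norm lies below both arguments, so a conjunction of value 1 forces both residual
  implications to be 1, which are the two inequalities.\<close>

lemma models_biresiduumD:
  assumes T: "left_continuous_tnorm T"
    and F: "eval_formula I F \<in> {0..1}" and G: "eval_formula I G \<in> {0..1}"
    and "I \<Turnstile> biresiduum T F G"
  shows "eval_formula I F = eval_formula I G"
proof -
  define u where "u = residual_implicator T (eval_formula I F) (eval_formula I G)"
  define v where "v = residual_implicator T (eval_formula I G) (eval_formula I F)"
  have tn: "tnorm T" using T unfolding left_continuous_tnorm_def by blast
  have uv: "u \<in> {0..1}" "v \<in> {0..1}"
    unfolding u_def v_def using residual_implicator_range[OF tn] F G by blast+
  have "T u v = 1"
    using assms(4) by (simp add: models_def biresiduum_def u_def v_def)
  then have "u = 1" "v = 1"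
    using tnorm_le_left[OF tn uv] tnorm_le_right[OF tn uv] uv by auto
  then show ?thesis
    unfolding u_def v_def using residual_implicator_eq_1_iff[OF T] F G by force
qed

lemma eval_conj_formula_range:
  assumes "tnorm T" "\<And>F. F \<in> set Fs \<Longrightarrow> eval_formula I F \<in> {0..1}"
  shows "eval_formula I (conj_formula T Fs) \<in> {0..1}"
  using assms(2)
\<comment> \<open>The cases empty, singleton and longer match the equations of
  \<open>conj_formula\<close>.\<close>
proof (induction Fs rule: induct_list012)
  case (3 F G Gs)
  then show ?case using tnorm_range[OF assms(1)] by (simp del: atLeastAtMost_iff)
qed auto

lemma eval_conj_formula_mono:
  assumes T: "tnorm T"
    and "\<And>b. b \<in> set bs \<Longrightarrow> eval_formula K (f b) \<in> {0..1}"
    and "\<And>b. b \<in> set bs \<Longrightarrow> eval_formula K' (g b) \<in> {0..1}"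
    and "\<And>b. b \<in> set bs \<Longrightarrow> eval_formula K (f b) \<le> eval_formula K' (g b)"
  shows "eval_formula K (conj_formula T (map f bs)) \<le> eval_formula K' (conj_formula T (map g bs))"
  using assms(2-)
proof (induction bs rule: induct_list012)
  case (3 b c cs)
  have "eval_formula K (conj_formula T (map f (c # cs))) \<in> {0..1}"
       "eval_formula K' (conj_formula T (map g (c # cs))) \<in> {0..1}"
    by (rule eval_conj_formula_range[OF T]; use 3(3,4) in auto)+
  moreover have "eval_formula K (conj_formula T (map f (c # cs)))
      \<le> eval_formula K' (conj_formula T (map g (c # cs)))"
    using 3 by simp
  ultimately show ?case
    using 3(3-5)[of b] tnorm_mono[OF T] by simp
qed auto

text \<open>Iterates the fact that a t-norm lies below each of its arguments.\<close>

lemma eval_conj_formula_le: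
  assumes T: "tnorm T" and "\<And>F. F \<in> set Fs \<Longrightarrow> eval_formula I F \<in> {0..1}" and "F \<in> set Fs"
  shows "eval_formula I (conj_formula T Fs) \<le> eval_formula I F"
  using assms(2-)
proof (induction Fs rule: induct_list012)
  case (3 G H Hs)
  have "eval_formula I (conj_formula T (H # Hs)) \<in> {0..1}"
    by (rule eval_conj_formula_range[OF T]) (use 3(3) in auto)
  moreover have "eval_formula I G \<in> {0..1}" using 3(3) by simp
  ultimately have le: "eval_formula I (conj_formula T (G # H # Hs)) \<le> eval_formula I G"
      "eval_formula I (conj_formula T (G # H # Hs)) \<le> eval_formula I (conj_formula T (H # Hs))"
    using tnorm_le_left[OF T] tnorm_le_right[OF T] by auto
  show ?case
  proof (cases "F = G")
    case False
    then have "eval_formula I (conj_formula T (H # Hs)) \<le> eval_formula I F"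
      using 3 by simp
    with le(2) show ?thesis by linarith
  qed (use le(1) in simp)
qed auto

section \<open>Rules and reducts\<close>

lemma finite_atoms: "fasp_program P \<Longrightarrow> finite (atoms P)"
proof -
  have "finite (set_literal l)" for l :: "'a literal" by (cases l) auto
  moreover from this have "finite (set_ext_literal b)" for b :: "'a ext_literal" by (cases b) auto
  ultimately show "fasp_program P \<Longrightarrow> finite (atoms P)"
    unfolding atoms_def rule_atoms_def fasp_program_def by auto
qed

lemma finite_rules_for: "fasp_program P \<Longrightarrow> finite (rules_for P a)"
  unfolding fasp_program_def rules_for_def by auto

lemma tnorm_rule_tnorm: "wf_rule r \<Longrightarrow> tnorm (rule_tnorm r)"
  unfolding wf_rule_def left_continuous_tnorm_def by blast

lemma eval_ext_literal_range:
  assumes "wf_ext_literal b" "\<And>a. a \<in> set_ext_literal b \<Longrightarrow> K a \<in> {0..1}"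
  shows "eval_formula K (ext_literal_formula b) \<in> {0..1}"
proof (cases b)
  case (Pos l)
  then show ?thesis using assms by (cases l) auto
next
  case (Neg N a)
  then have "N \<in> {0..1} \<rightarrow> {0..1}" "K a \<in> {0..1}" using assms by (auto simp: negator_def)
  then show ?thesis using Neg by (simp add: Pi_iff)
qed

lemma wf_reduct_ext_literal:
  assumes "wf_ext_literal b" "\<And>a. a \<in> set_ext_literal b \<Longrightarrow> I a \<in> {0..1}"
  shows "wf_ext_literal (reduct_ext_literal I b)"
  using assms by (cases b) (auto simp: negator_def Pi_iff)

lemma set_reduct_ext_literal: "set_ext_literal (reduct_ext_literal I b) \<subseteq> set_ext_literal b"
  by (cases b) auto

lemma interpretation_range:
  "\<lbrakk>I \<in> interpretations P; a \<in> atoms P\<rbrakk> \<Longrightarrow> I a \<in> {0..1}"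
  unfolding interpretations_def by auto

lemma eval_body_range:
  assumes "wf_rule r" "\<And>a. a \<in> rule_atoms r \<Longrightarrow> K a \<in> {0..1}"
  shows "eval_formula K (body_formula r) \<in> {0..1}"
  unfolding body_formula_def
proof (rule eval_conj_formula_range[OF tnorm_rule_tnorm[OF assms(1)]])
  fix F assume "F \<in> set (map ext_literal_formula (body r))"
  then obtain b where b: "b \<in> set (body r)" "F = ext_literal_formula b" by auto
  then show "eval_formula K F \<in> {0..1}"
    using assms unfolding wf_rule_def rule_atoms_def
    by (auto intro!: eval_ext_literal_range simp del: atLeastAtMost_iff)
qed

lemma eval_body_le_pos_atom:
  assumes "wf_rule r" "\<And>a. a \<in> rule_atoms r \<Longrightarrow> K a \<in> {0..1}" "Atom a \<in> pos_literals r"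
  shows "eval_formula K (body_formula r) \<le> K a"
proof -
  have "eval_formula K (body_formula r) \<le> eval_formula K (ext_literal_formula (Pos (Atom a)))"
    unfolding body_formula_def
  proof (rule eval_conj_formula_le[OF tnorm_rule_tnorm[OF assms(1)]])
    fix F assume "F \<in> set (map ext_literal_formula (body r))"
    then obtain b where b: "b \<in> set (body r)" "F = ext_literal_formula b" by auto
    then show "eval_formula K F \<in> {0..1}"
      using assms unfolding wf_rule_def rule_atoms_def
      by (auto intro!: eval_ext_literal_range simp del: atLeastAtMost_iff)
  qed (use assms(3) in \<open>force simp: pos_literals_def\<close>)
  then show ?thesis by simp
qed

lemma wf_reduct_rule:
  assumes "wf_rule r" "\<And>a. a \<in> rule_atoms r \<Longrightarrow> I a \<in> {0..1}"
  shows "wf_rule (reduct_rule I r)"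
  using assms unfolding wf_rule_def rule_atoms_def reduct_rule_def
  by (auto intro!: wf_reduct_ext_literal simp del: atLeastAtMost_iff)

lemma rule_atoms_reduct: "rule_atoms (reduct_rule I r) \<subseteq> rule_atoms r"
  unfolding rule_atoms_def reduct_rule_def using set_reduct_ext_literal by fastforce

text \<open>The reduct freezes each negated atom at exactly the value that \<open>I\<close> gives
  it, so \<open>I\<close> cannot tell the two bodies apart.\<close>

lemma eval_reduct_body_self:
  "eval_formula I (body_formula (reduct_rule I r)) = eval_formula I (body_formula r)"
proof -
  have "eval_formula I (conj_formula T (map ext_literal_formula (map (reduct_ext_literal I) bs)))
      = eval_formula I (conj_formula T (map ext_literal_formula bs))" for T and bs :: "'a ext_literal list"
  proof -
    have "eval_formula I (ext_literal_formula (reduct_ext_literal I b))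
        = eval_formula I (ext_literal_formula b)" for b :: "'a ext_literal"
      by (cases b) auto
    then show ?thesis
      by (induction bs rule: induct_list012) auto
  qed
  then show ?thesis by (simp add: body_formula_def reduct_rule_def)
qed

text \<open>Frozen negations have the same value under \<open>K\<close> and \<open>K'\<close>, so
  only the positive atoms of this one rule have to be compared. This local form also applies to
  \<open>I\<close> and the least fixpoint, in the direction opposite to their global order.\<close>

lemma eval_reduct_body_mono:
  assumes wf: "wf_rule r"
    and I: "\<And>a. a \<in> rule_atoms r \<Longrightarrow> I a \<in> {0..1}"
    and K: "\<And>a. a \<in> rule_atoms r \<Longrightarrow> K a \<in> {0..1}"
    and K': "\<And>a. a \<in> rule_atoms r \<Longrightarrow> K' a \<in> {0..1}"
    and le: "\<And>a. Atom a \<in> pos_literals r \<Longrightarrow> K a \<le> K' a"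
  shows "eval_formula K (body_formula (reduct_rule I r))
    \<le> eval_formula K' (body_formula (reduct_rule I r))"
proof -
  have range: "eval_formula H (ext_literal_formula (reduct_ext_literal I b)) \<in> {0..1}"
    if b: "b \<in> set (body r)" and H: "\<And>a. a \<in> rule_atoms r \<Longrightarrow> H a \<in> {0..1}" for H b
  proof (rule eval_ext_literal_range)
    show "wf_ext_literal (reduct_ext_literal I b)"
      using b wf I unfolding wf_rule_def rule_atoms_def by (intro wf_reduct_ext_literal) auto
    show "H a \<in> {0..1}" if "a \<in> set_ext_literal (reduct_ext_literal I b)" for a
      using that b set_reduct_ext_literal[of I b] by (intro H) (auto simp: rule_atoms_def)
  qed
  have "eval_formula K (ext_literal_formula (reduct_ext_literal I b))
      \<le> eval_formula K' (ext_literal_formula (reduct_ext_literal I b))" if b: "b \<in> set (body r)" for b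
  proof (cases b)
    case (Pos l)
    then show ?thesis using b le by (cases l) (auto simp: pos_literals_def)
  qed simp
  with range K K' show ?thesis
    unfolding body_formula_def reduct_rule_def rule.sel map_map comp_def
    by (intro eval_conj_formula_mono tnorm_rule_tnorm[OF wf]) auto
qed

text \<open>Finitely many rules turn the supremum into a maximum. It is indexed by rules of
  \<open>P\<close>, so that several rules with the same reduct do no harm.\<close>

lemma immediate_consequence_reduct:
  assumes "fasp_program P" "a \<in> B"
  shows "immediate_consequence B (reduct P I) K a =
    (if rules_for P a = {} then 0
     else Max ((\<lambda>r. eval_formula K (body_formula (reduct_rule I r))) ` rules_for P a))"
proof -
  have "rules_for (reduct P I) a = reduct_rule I ` rules_for P a"
    unfolding rules_for_def reduct_def by (auto simp: reduct_rule_def intro!: rev_image_eqI)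
  then show ?thesis
    using assms finite_rules_for[OF assms(1), of a]
    by (auto simp: immediate_consequence_def cSup_eq_Max image_image)
qed

section \<open>Least fixpoints\<close>

text \<open>Knaster-Tarski on a cube: the pointwise infimum of the pre-fixpoints is the least
  fixpoint. Outside \<open>B\<close> all functions involved are \<open>undefined\<close>, so the
  order on functions is trivial there.\<close>

lemma least_fixpoint_PiE_unit:
  fixes F :: "('a \<Rightarrow> real) \<Rightarrow> 'a \<Rightarrow> real"
  assumes F: "\<And>K. K \<in> B \<rightarrow>\<^sub>E {0..1} \<Longrightarrow> F K \<in> B \<rightarrow>\<^sub>E {0..1}"
    and mono: "\<And>K K'. \<lbrakk>K \<in> B \<rightarrow>\<^sub>E {0..1}; K' \<in> B \<rightarrow>\<^sub>E {0..1}; K \<le> K'\<rbrakk> \<Longrightarrow> F K \<le> F K'"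
  obtains J where "J \<in> B \<rightarrow>\<^sub>E {0..1}" "F J = J"
    "\<And>K. \<lbrakk>K \<in> B \<rightarrow>\<^sub>E {0..1}; F K \<le> K\<rbrakk> \<Longrightarrow> J \<le> K"
proof -
  define Pre where "Pre = {K \<in> B \<rightarrow>\<^sub>E {0..1}. F K \<le> K}"
  define J where "J = (\<lambda>a\<in>B. Inf ((\<lambda>K. K a) ` Pre))"
  define top where "top = (\<lambda>a\<in>B. 1 :: real)"
  \<comment> \<open>The constant 1 is a pre-fixpoint because \<open>F\<close> stays in the cube;
    hence the infima range over non-empty sets.\<close>
  have top: "top \<in> Pre"
  proof -
    have "top \<in> B \<rightarrow>\<^sub>E {0..1}" by (auto simp: top_def)
    moreover from F[OF this] have "F top \<le> top"
      by (auto simp: le_fun_def top_def PiE_iff extensional_def)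
    ultimately show ?thesis by (simp add: Pre_def)
  qed
  have le: "J \<le> K" if "K \<in> Pre" for K
  proof (rule le_funI)
    fix a
    show "J a \<le> K a"
    proof (cases "a \<in> B")
      case True
      have "bdd_below ((\<lambda>K. K a) ` Pre)"
        using True by (auto simp: Pre_def PiE_iff intro!: bdd_belowI[where m = 0])
      then show ?thesis using True that by (auto simp: J_def intro: cInf_lower)
    next
      case False
      then show ?thesis using that by (auto simp: J_def Pre_def PiE_iff extensional_def)
    qed
  qed
  have J: "J \<in> B \<rightarrow>\<^sub>E {0..1}"
  proof -
    have "0 \<le> J a" if "a \<in> B" for a
      using that top unfolding J_def by (auto simp: Pre_def PiE_iff intro!: cInf_greatest)
    moreover have "J a \<le> 1" if "a \<in> B" for a
      using le_funD[OF le[OF top], of a] that by (simp add: top_def)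
    ultimately show ?thesis by (auto simp: PiE_iff J_def)
  qed
  have "F J \<le> J"
  proof (rule le_funI)
    fix a
    show "F J a \<le> J a"
    proof (cases "a \<in> B")
      case True
      have "F J a \<le> K a" if K: "K \<in> Pre" for K
      proof -
        have "F J \<le> F K" using mono[OF J _ le[OF K]] K by (simp add: Pre_def)
        also have "\<dots> \<le> K" using K by (simp add: Pre_def)
        finally show ?thesis by (rule le_funD)
      qed
      then show ?thesis
        using True top by (auto simp: J_def intro!: cInf_greatest)
    next
      case False
      then show ?thesis using F[OF J] J by (auto simp: PiE_iff extensional_def)
    qed
  qed
  \<comment> \<open>By monotonicity \<open>F J\<close> is again a pre-fixpoint, so \<open>J\<close>
    lies below it.\<close>
  moreover have "J \<le> F J"
    using mono[OF F[OF J] J \<open>F J \<le> J\<close>] F[OF J] by (intro le) (simp add: Pre_def)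
  ultimately show thesis
    using that[OF J] le by (auto simp: Pre_def)
qed

text \<open>Justifies the \<open>LEAST\<close> in the definition by exhibiting a least element, and
  strengthens minimality to all pre-fixpoints.\<close>

lemma reduct_least_fixpoint:
  assumes P: "fasp_program P" and I: "I \<in> interpretations P"
  defines "F \<equiv> immediate_consequence (atoms P) (reduct P I)"
  shows "reduct_least_fixpoint P I \<in> interpretations P" (is ?mem)
    and "F (reduct_least_fixpoint P I) = reduct_least_fixpoint P I" (is ?fix)
    and "\<And>K. \<lbrakk>K \<in> interpretations P; F K \<le> K\<rbrakk> \<Longrightarrow> reduct_least_fixpoint P I \<le> K"
proof -
  have ra: "K a \<in> {0..1}" if "K \<in> interpretations P" "r \<in> P" "a \<in> rule_atoms r" for K r a
    using that interpretation_range[of K P a] by (auto simp: atoms_def)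
  have wf: "wf_rule r" if "r \<in> P" for r using that P by (simp add: fasp_program_def)
  have rP: "r \<in> P" if "r \<in> rules_for P a" for r a using that by (simp add: rules_for_def)
  have body: "eval_formula K (body_formula (reduct_rule I r)) \<in> {0..1}"
    if "K \<in> interpretations P" "r \<in> P" for K r
    using that rule_atoms_reduct[of I r]
    by (intro eval_body_range wf_reduct_rule wf) (auto intro!: ra I simp del: atLeastAtMost_iff)
  have "F K a \<in> {0..1}" if "K \<in> interpretations P" "a \<in> atoms P" for K a
  proof (cases "rules_for P a = {}")
    case True
    then show ?thesis using immediate_consequence_reduct[OF P that(2)] by (simp add: F_def)
  next
    case False
    let ?A = "(\<lambda>r. eval_formula K (body_formula (reduct_rule I r))) ` rules_for P a"
    have "Max ?A \<in> ?A" using False finite_rules_for[OF P] by (intro Max_in) auto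
    then show ?thesis
      using body[OF that(1)] rP False immediate_consequence_reduct[OF P that(2)]
      by (auto simp: F_def simp del: atLeastAtMost_iff)
  qed
  then have range: "F K \<in> atoms P \<rightarrow>\<^sub>E {0..1}" if "K \<in> atoms P \<rightarrow>\<^sub>E {0..1}" for K
    using that by (auto simp: interpretations_def F_def immediate_consequence_def)
  have mono: "F K \<le> F K'"
    if K: "K \<in> atoms P \<rightarrow>\<^sub>E {0..1}" and K': "K' \<in> atoms P \<rightarrow>\<^sub>E {0..1}" and le: "K \<le> K'" for K K'
  proof (rule le_funI)
    fix a
    show "F K a \<le> F K' a"
    proof (cases "a \<in> atoms P \<and> rules_for P a \<noteq> {}")
      case True
      have "eval_formula K (body_formula (reduct_rule I r))
          \<le> eval_formula K' (body_formula (reduct_rule I r))" if "r \<in> rules_for P a" for r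
        using that rP le K K' I
        by (intro eval_reduct_body_mono wf)
          (auto intro!: ra simp: interpretations_def le_fun_def simp del: atLeastAtMost_iff)
      then show ?thesis
        using True finite_rules_for[OF P, of a]
        by (auto simp: F_def immediate_consequence_reduct[OF P] intro!: Max.boundedI
            intro: order_trans[OF _ Max_ge])
    next
      \<comment> \<open>Both sides are 0 for an atom without rules, and \<open>undefined\<close>
        outside \<open>atoms P\<close>.\<close>
      case False
      then show ?thesis
        by (cases "a \<in> atoms P")
          (auto simp: F_def immediate_consequence_reduct[OF P], auto simp: immediate_consequence_def)
    qed
  qed
  obtain J where J: "J \<in> interpretations P" "F J = J"
    "\<And>K. \<lbrakk>K \<in> interpretations P; F K \<le> K\<rbrakk> \<Longrightarrow> J \<le> K"
    using least_fixpoint_PiE_unit[of "atoms P" F] range mono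
    unfolding interpretations_def by blast
  have "reduct_least_fixpoint P I = J"
    unfolding reduct_least_fixpoint_def F_def[symmetric]
    using J by (intro Least_equality) auto
  with J show ?mem ?fix
    "\<And>K. \<lbrakk>K \<in> interpretations P; F K \<le> K\<rbrakk> \<Longrightarrow> reduct_least_fixpoint P I \<le> K"
    by auto
qed

lemma completion_model_eq_max:
  assumes P: "fasp_program P" and I: "I \<in> interpretations P"
    and T: "left_continuous_tnorm (T a)" and comp: "I \<Turnstile>\<^sub>s fasp_completion T P"
    and a: "a \<in> atoms P"
  shows "I a = eval_formula I (max_formula (body_formula ` rules_for P a))"
proof -
  have "eval_formula I (body_formula r) \<in> {0..1}" if "r \<in> rules_for P a" for r
    using that P interpretation_range[OF I]
    by (intro eval_body_range) (auto simp: rules_for_def fasp_program_def atoms_def)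
  then have "eval_formula I (max_formula (body_formula ` rules_for P a)) \<in> {0..1}"
    using finite_rules_for[OF P] by (intro eval_max_formula_range) auto
  moreover have "I \<Turnstile> biresiduum (T a) (Lit (Atom a)) (max_formula (body_formula ` rules_for P a))"
    using comp a by (auto simp: models_set_def fasp_completion_def)
  ultimately show ?thesis
    using models_biresiduumD[OF T, of I "Lit (Atom a)"] interpretation_range[OF I a] by auto
qed

section \<open>Loops\<close>

text \<open>A minimal non-empty closed \<open>L\<close> exists by finiteness. The points reachable
  from a member inside \<open>L\<close> form a closed non-empty subset, which by minimality is all
  of \<open>L\<close>.\<close>

lemma closed_strongly_connected_subset:
  assumes "finite X" "X \<noteq> {}" and succ: "\<And>a. a \<in> X \<Longrightarrow> \<exists>b\<in>X. (a, b) \<in> R"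
  obtains L where "L \<subseteq> X" "L \<noteq> {}" "\<And>a b. \<lbrakk>a \<in> L; b \<in> X; (a, b) \<in> R\<rbrakk> \<Longrightarrow> b \<in> L"
    "\<And>a b. \<lbrakk>a \<in> L; b \<in> L\<rbrakk> \<Longrightarrow> (a, b) \<in> (R \<inter> L \<times> L)\<^sup>+"
proof -
  define closed where
    "closed = {L. L \<subseteq> X \<and> L \<noteq> {} \<and> (\<forall>a\<in>L. \<forall>b\<in>X. (a, b) \<in> R \<longrightarrow> b \<in> L)}"
  have "finite closed"
    by (rule finite_subset[of _ "Pow X"]) (auto simp: closed_def assms(1))
  moreover have "X \<in> closed" using assms(2) by (auto simp: closed_def)
  ultimately obtain L where L: "L \<in> closed" and minimal: "\<And>L'. \<lbrakk>L' \<in> closed; L' \<subseteq> L\<rbrakk> \<Longrightarrow> L = L'"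
    using finite_has_minimal[of closed] by blast
  have "(a, b) \<in> (R \<inter> L \<times> L)\<^sup>+" if a: "a \<in> L" and b: "b \<in> L" for a b
  proof -
    \<comment> \<open>Paths of positive length are used, so that a single point also needs an edge
      to itself; \<open>succ\<close> then provides the first step.\<close>
    define D where "D = {d. (a, d) \<in> (R \<inter> L \<times> L)\<^sup>+}"
    have "D \<subseteq> L"
      unfolding D_def using trancl_subset_Sigma[of "R \<inter> L \<times> L" L] by auto
    moreover have "D \<noteq> {}"
    proof -
      obtain d where "d \<in> X" "(a, d) \<in> R" using succ[of a] a L by (auto simp: closed_def)
      then have "(a, d) \<in> R \<inter> L \<times> L" using a L by (auto simp: closed_def)
      then show ?thesis unfolding D_def by blast
    qed
    moreover have "e \<in> D" if "d \<in> D" "e \<in> X" "(d, e) \<in> R" for d e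
    proof -
      have "d \<in> L" using that \<open>D \<subseteq> L\<close> by blast
      then have "(d, e) \<in> R \<inter> L \<times> L" using that L by (auto simp: closed_def)
      then show ?thesis using that(1) unfolding D_def by (auto intro: trancl_into_trancl)
    qed
    ultimately have "D \<in> closed" using L by (auto simp: closed_def)
    then show ?thesis using minimal \<open>D \<subseteq> L\<close> b unfolding D_def by blast
  qed
  then show thesis using L that unfolding closed_def by blast
qed

section \<open>From a completion model other than the least fixpoint to a violated loop
  formula\<close>

theorem proposition6:
  fixes P :: "'a rule set" and I :: "'a \<Rightarrow> real"
    and T\<^sub>c :: "'a \<Rightarrow> real \<Rightarrow> real \<Rightarrow> real" and T\<^sub>l :: "'a set \<Rightarrow> real \<Rightarrow> real \<Rightarrow> real"
  assumes "fasp_program P"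
    and "I \<in> interpretations P"
    and "\<And>a. left_continuous_tnorm (T\<^sub>c a)"
    and "\<And>L. left_continuous_tnorm (T\<^sub>l L)"
    and "I \<Turnstile>\<^sub>s fasp_completion T\<^sub>c P"
    and "I \<noteq> reduct_least_fixpoint P I"
  shows "\<exists>L. loop P L \<and> L \<subseteq> supp P (interp_diff P I (reduct_least_fixpoint P I)) \<and>
           \<not> I \<Turnstile> loop_formula (T\<^sub>l L) L P"
proof -
  note P = assms(1) and I = assms(2)
  define J where "J = reduct_least_fixpoint P I"
  define F where "F = immediate_consequence (atoms P) (reduct P I)"
  \<comment> \<open>Body values with the negations frozen at \<open>I\<close>; for \<open>I\<close>
    itself these are the original body values.\<close>
  define v where "v K r = eval_formula K (body_formula (reduct_rule I r))" for K r
  have vI: "v I r = eval_formula I (body_formula r)" for r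
    by (simp add: v_def eval_reduct_body_self)
  have wf: "wf_rule r" if "r \<in> P" for r using that P by (simp add: fasp_program_def)
  have ra: "K a \<in> {0..1}" if "K \<in> interpretations P" "r \<in> P" "a \<in> rule_atoms r" for K r a
    using that interpretation_range[of K P a] by (auto simp: atoms_def)
  have pos_atoms: "a \<in> rule_atoms r" if "Atom a \<in> pos_literals r" for a and r :: "'a rule"
    using that by (force simp: pos_literals_def rule_atoms_def)
  have I_eq: "I a = (if rules_for P a = {} then 0 else Max (v I ` rules_for P a))"
    if "a \<in> atoms P" for a
    using completion_model_eq_max[OF P I assms(3,5) that] finite_rules_for[OF P, of a]
    by (auto simp: eval_max_formula image_image vI)
  have "F I = I"
  proof
    fix a
    show "F I a = I a"
      using I I_eq immediate_consequence_reduct[OF P, of a "atoms P"]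
      by (cases "a \<in> atoms P")
        (auto simp: F_def v_def, auto simp: immediate_consequence_def interpretations_def PiE_iff
          extensional_def)
  qed
  note lfp = reduct_least_fixpoint[OF P I, folded F_def, folded J_def]
  have JI: "J \<le> I" using lfp(3)[OF I] \<open>F I = I\<close> by simp
  have vJ: "v J r \<le> J a" if "r \<in> rules_for P a" "a \<in> atoms P" for r a
  proof -
    have "J a = Max (v J ` rules_for P a)"
      using lfp(2) immediate_consequence_reduct[OF P that(2), of I J] that(1)
      by (auto simp: F_def v_def)
    then show ?thesis using that finite_rules_for[OF P, of a] by simp
  qed

  define S where "S = supp P (interp_diff P I J)"
  have S: "a \<in> S \<longleftrightarrow> a \<in> atoms P \<and> J a < I a" for a
    by (auto simp: S_def supp_def interp_diff_def)
  have "S \<noteq> {}"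
  proof
    assume "S = {}"
    then have "I a = J a" for a
      using S[of a] le_funD[OF JI, of a] I lfp(1)
      by (cases "a \<in> atoms P") (auto simp: interpretations_def PiE_iff extensional_def)
    then show False using assms(6) by (auto simp: J_def)
  qed
  have "finite S" using finite_atoms[OF P] by (rule finite_subset[rotated]) (auto simp: S)

  define M where "M = Max (I ` S)"
  define X where "X = {a \<in> S. I a = M}"
  have le_M: "I a \<le> M" if "a \<in> S" for a
    using that \<open>finite S\<close> by (simp add: M_def)
  have "finite X" using \<open>finite S\<close> by (simp add: X_def)
  have "X \<noteq> {}"
    using Max_in[of "I ` S"] \<open>finite S\<close> \<open>S \<noteq> {}\<close> by (auto simp: X_def M_def simp del: Max_in)
  \<comment> \<open>Only rules whose body reaches \<open>M\<close> contribute edges. This is a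
    subgraph of the dependency graph, so its paths carry over, and closedness under it is what
    bounds the external bodies.\<close>
  define R where
    "R = {(a, b). \<exists>r\<in>rules_for P a. M \<le> v I r \<and> Atom b \<in> pos_literals r}"
  have edge: "\<exists>b\<in>X. Atom b \<in> pos_literals r"
    if a: "a \<in> X" and r: "r \<in> rules_for P a" and M: "M \<le> v I r" for a r
  proof -
    have rP: "r \<in> P" using r by (simp add: rules_for_def)
    \<comment> \<open>The chain is: v J r is at most J a, which is less than I a = M, which is at
      most v I r.\<close>
    have "v J r < v I r"
      using vJ[OF r] a M by (auto simp: X_def S)
    \<comment> \<open>Otherwise the monotonicity of reduct bodies, applied from \<open>I\<close> to
      \<open>J\<close>, would reverse this inequality.\<close>
    then have "\<not> (\<forall>b. Atom b \<in> pos_literals r \<longrightarrow> I b \<le> J b)"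
      using eval_reduct_body_mono[OF wf[OF rP], of I I J] ra[OF I rP] ra[OF lfp(1) rP]
      unfolding v_def by fastforce
    then obtain b where b: "Atom b \<in> pos_literals r" "J b < I b"
      by force
    have "b \<in> S" using b rP pos_atoms[of b r] by (auto simp: S atoms_def)
    moreover have "M \<le> I b"
      using M eval_body_le_pos_atom[of r I b] wf[OF rP] ra[OF I rP] b(1) by (force simp: vI)
    ultimately have "b \<in> X" using le_M by (force simp: X_def)
    with b(1) show ?thesis by blast
  qed
  have succ: "\<exists>b\<in>X. (a, b) \<in> R" if a: "a \<in> X" for a
  proof -
    \<comment> \<open>As J a is non-negative, I a is positive. This excludes the default value 0 of
      an atom without rules, so some rule attains \<open>M\<close>.\<close>
    have aP: "a \<in> atoms P" and "0 < I a" "I a = M"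
      using a interpretation_range[OF lfp(1), of a] by (auto simp: X_def S)
    then have "rules_for P a \<noteq> {}" and "M = Max (v I ` rules_for P a)"
      using I_eq by (auto split: if_splits)
    then have "M \<in> v I ` rules_for P a" using finite_rules_for[OF P] by simp
    then obtain r where "r \<in> rules_for P a" "v I r = M" by blast
    then show ?thesis using edge[OF a, of r] by (auto simp: R_def)
  qed
  obtain L where L: "L \<subseteq> X" "L \<noteq> {}" "\<And>a b. \<lbrakk>a \<in> L; b \<in> X; (a, b) \<in> R\<rbrakk> \<Longrightarrow> b \<in> L"
    "\<And>a b. \<lbrakk>a \<in> L; b \<in> L\<rbrakk> \<Longrightarrow> (a, b) \<in> (R \<inter> L \<times> L)\<^sup>+"
    using closed_strongly_connected_subset[OF \<open>finite X\<close> \<open>X \<noteq> {}\<close> succ] by blast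
  have LS: "L \<subseteq> S" using L(1) by (auto simp: X_def)
  have "R \<inter> L \<times> L \<subseteq> dependency_graph P \<inter> L \<times> L"
    by (auto simp: R_def dependency_graph_def)
  then have "(R \<inter> L \<times> L)\<^sup>+ \<subseteq> (dependency_graph P \<inter> L \<times> L)\<^sup>+"
    by (auto intro: trancl_mono)
  then have "loop P L"
    using L(2,4) LS by (auto simp: loop_def S)

  obtain l where l: "l \<in> atoms P" "J l < I l" "I l = M"
    using L(1,2) by (auto simp: X_def S)
  \<comment> \<open>A body reaching \<open>M\<close> would have a positive atom in \<open>X\<close>;
    closedness puts it into \<open>L\<close>, which an external rule forbids.\<close>
  have "v I r < M" if r: "r \<in> external_rules P L" for r
  proof (rule ccontr)
    assume "\<not> v I r < M"
    from r obtain a where a: "a \<in> L" "r \<in> rules_for P a" "pos_literals r \<inter> Atom ` L = {}"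
      by (auto simp: external_rules_def rules_for_def)
    then obtain b where b: "b \<in> X" "Atom b \<in> pos_literals r"
      using edge[of a r] \<open>\<not> v I r < M\<close> L(1) by auto
    then have "(a, b) \<in> R" using a \<open>\<not> v I r < M\<close> by (auto simp: R_def)
    then show False using L(3) a b by blast
  qed
  moreover have "finite (external_rules P L)"
    using P by (simp add: external_rules_def fasp_program_def)
  \<comment> \<open>Covers the case without external rules, where the empty maximum is 0.\<close>
  moreover have "0 < M"
    using l interpretation_range[OF lfp(1), of l] by auto
  ultimately have ext_less: "eval_formula I (max_formula (body_formula ` external_rules P L)) < M"
    by (auto simp: eval_max_formula vI)
  have "eval_formula I (body_formula r) \<in> {0..1}" if "r \<in> external_rules P L" for r
    using that by (intro eval_body_range wf ra[OF I]) (auto simp: external_rules_def)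
  then have ext_range: "eval_formula I (max_formula (body_formula ` external_rules P L)) \<in> {0..1}"
    using \<open>finite (external_rules P L)\<close> by (intro eval_max_formula_range) auto

  have "finite L" using L(1) \<open>finite X\<close> finite_subset by blast
  have "I ` L = {M}" using L(1,2) by (auto simp: X_def)
  then have max_L: "eval_formula I (max_formula ((\<lambda>l. Lit (Atom l)) ` L)) = M"
    using \<open>finite L\<close> L(2) by (simp add: eval_max_formula image_image)
  moreover have "M \<in> {0..1}"
    using l interpretation_range[OF I, of l] by simp
  \<comment> \<open>The premise of the loop formula has value \<open>M\<close> and its conclusion
    less, so the implication is not 1.\<close>
  ultimately have "\<not> I \<Turnstile> loop_formula (T\<^sub>l L) L P"
    using residual_implicator_eq_1_iff[OF assms(4) _ ext_range] ext_less
    by (simp add: models_def loop_formula_def)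
  with \<open>loop P L\<close> LS show ?thesis unfolding S_def J_def by blast
qed

end
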